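(* Let $p_0\ne p_1$ be distributions on a domain $\mathcal X$, let $B(p_0,p_1)=\sum_{x\in\mathcal X}\sqrt{p_0(x)p_1(x)}$ and $\theta=\cos^{-1}B(p_0,p_1)\in(0,\pi/2]$. Let $u$ be the distribution on $\mathcal X$ given by $$\sqrt{u(x)}=\frac{\sin(\theta/2)}{\sin\theta}\left(\sqrt{p_0(x)}+\sqrt{p_1(x)}\right),$$ and for $m\ge1$ define the statistic $$T(X^m)=\frac1m\sum_{i=1}^m\left(\sqrt{\frac{p_0(X_i)}{u(X_i)}}-\sqrt{\frac{p_1(X_i)}{u(X_i)}}\right).$$ For every $r<1-\cos\frac{\theta}{2}$, the test based on $T$ (declare $H_0$ if $T(X^m)\ge0$ and $H_1$ otherwise) distinguishes between $$H_0:\ H^2(p,p_0)\le r\qquad\text{and}\qquad H_1:\ H^2(p,p_1)\le r.$$ That is, for every $\delta\in(0,1)$ there is a finite $m_0$ (depending only on $\delta,p_0,p_1,r$) such that for every $m\ge m_0$ and every distribution $p$ on $\mathcal X$, when $X^m=(X_1,\dots,X_m)$ consists of $m$ i.i.d. samples from $p$: if $p$ satisfies $H_0$ the test declares $H_0$ with probability at least $1-\delta$, and if $p$ satisfies $H_1$ the test declares $H_1$ with probability at least $1-\delta$.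
   Context: The domain $\mathcal X$ is taken to be discrete (countable) and distributions are probability mass functions on $\mathcal X$; the continuous case $\mathcal X=\mathbb R^d$ is analogous, with Lebesgue densities in place of probability mass functions and integrals in place of sums. Squared Hellinger distance: $H^2(p,q)=\frac12\sum_{x}\left(\sqrt{p(x)}-\sqrt{q(x)}\right)^2=1-B(p,q)$, where $B(p,q)=\sum_x\sqrt{p(x)q(x)}$. At points $x$ with $u(x)=0$ (equivalently $p_0(x)=p_1(x)=0$), the ratios $p_0(x)/u(x)$ and $p_1(x)/u(x)$ are taken to be $0$. *)

theory Defs
  imports "HOL-Probability.Probability"
begin

definition bhattacharyya :: "'a pmf \<Rightarrow> 'a pmf \<Rightarrow> real" where
  "bhattacharyya p q = (\<Sum>\<^sub>\<infinity>x. sqrt (pmf p x * pmf q x))"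

definition hellinger_sq :: "'a pmf \<Rightarrow> 'a pmf \<Rightarrow> real" where
  "hellinger_sq p q = 1 / 2 * (\<Sum>\<^sub>\<infinity>x. (sqrt (pmf p x) - sqrt (pmf q x))\<^sup>2)"

definition hellinger_angle :: "'a pmf \<Rightarrow> 'a pmf \<Rightarrow> real" where
  "hellinger_angle p q = arccos (bhattacharyya p q)"

(* For p \<noteq> q the function below is a probability mass function, so that embed_pmf is
   meaningful here; see sqrt_pmf_midpoint_pmf. *)
definition midpoint_pmf :: "'a pmf \<Rightarrow> 'a pmf \<Rightarrow> 'a pmf" where
  "midpoint_pmf p q = embed_pmf (\<lambda>x.
     (sin (hellinger_angle p q / 2) / sin (hellinger_angle p q)
        * (sqrt (pmf p x) + sqrt (pmf q x)))\<^sup>2)"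

(* The sample is X 1, ..., X m. Where the midpoint vanishes, the ratios are 0 since x / 0 = 0. *)
definition hellinger_stat :: "'a pmf \<Rightarrow> 'a pmf \<Rightarrow> nat \<Rightarrow> (nat \<Rightarrow> 'a) \<Rightarrow> real" where
  "hellinger_stat p0 p1 m X = 1 / real m *
     (\<Sum>i = 1..m. sqrt (pmf p0 (X i) / pmf (midpoint_pmf p0 p1) (X i))
                - sqrt (pmf p1 (X i) / pmf (midpoint_pmf p0 p1) (X i)))"

datatype hypothesis = H0 | H1

definition hellinger_test :: "'a pmf \<Rightarrow> 'a pmf \<Rightarrow> nat \<Rightarrow> (nat \<Rightarrow> 'a) \<Rightarrow> hypothesis" where
  "hellinger_test p0 p1 m X = (if hellinger_stat p0 p1 m X \<ge> 0 then H0 else H1)"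

(* The law of m i.i.d. samples from p; coordinates outside {1..m} are constantly undefined. *)
definition iid_sample :: "nat \<Rightarrow> 'a pmf \<Rightarrow> (nat \<Rightarrow> 'a) pmf" where
  "iid_sample m p = Pi_pmf {1..m} undefined (\<lambda>_. p)"


lemma pmf_has_sum: "(pmf p has_sum 1) UNIV"
proof -
  have "Infinite_Set_Sum.abs_summable_on (pmf p) UNIV"
    by (rule pmf_abs_summable)
  moreover from this have "infsum (pmf p) UNIV = 1"
    using infsetsum_infsum[of "pmf p" UNIV] infsetsum_pmf_eq_1[of p UNIV] by simp
  ultimately show ?thesis
    by (metis abs_summable_equivalent abs_summable_summable has_sum_infsum)
qed

lemma bhattacharyya_summable: "(\<lambda>x. sqrt (pmf p x * pmf q x)) summable_on UNIV"
proof (rule summable_on_comparison_test)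
  show "(\<lambda>x. pmf p x + pmf q x) summable_on UNIV"
    using pmf_has_sum by (intro summable_on_add) (auto simp: summable_on_def)
  show "sqrt (pmf p x * pmf q x) \<le> pmf p x + pmf q x" for x
    using arith_geo_mean_sqrt[OF pmf_nonneg[of p x] pmf_nonneg[of q x]]
    by (rule order_trans) simp
qed auto

lemma bhattacharyya_has_sum: "((\<lambda>x. sqrt (pmf p x * pmf q x)) has_sum bhattacharyya p q) UNIV"
  unfolding bhattacharyya_def by (rule has_sum_infsum[OF bhattacharyya_summable])

lemma bhattacharyya_nonneg: "bhattacharyya p q \<ge> 0"
  unfolding bhattacharyya_def by (intro infsum_nonneg) auto

lemma hellinger_has_sum:
  "((\<lambda>x. (sqrt (pmf p x) - sqrt (pmf q x))\<^sup>2) has_sum (2 - 2 * bhattacharyya p q)) UNIV"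
proof -
  have "((\<lambda>x. (pmf p x + pmf q x) + - 2 * sqrt (pmf p x * pmf q x)) has_sum
      ((1 + 1) + - 2 * bhattacharyya p q)) UNIV"
    by (intro has_sum_add has_sum_cmult_right pmf_has_sum bhattacharyya_has_sum)
  moreover have "(pmf p x + pmf q x) + - 2 * sqrt (pmf p x * pmf q x)
      = (sqrt (pmf p x) - sqrt (pmf q x))\<^sup>2" for x
    by (simp add: power2_diff real_sqrt_mult)
  ultimately show ?thesis by simp
qed

lemma hellinger_sq_eq: "hellinger_sq p q = 1 - bhattacharyya p q"
  unfolding hellinger_sq_def using infsumI[OF hellinger_has_sum[of p q]] by simp

lemma bhattacharyya_less_1:
  assumes "p \<noteq> q"
  shows "bhattacharyya p q < 1"
proof -
  obtain x where x: "pmf p x \<noteq> pmf q x"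
    using assms by (auto intro: pmf_eqI)
  have "(sqrt (pmf p x) - sqrt (pmf q x))\<^sup>2 > 0"
    using x by simp
  moreover have "(sqrt (pmf p x) - sqrt (pmf q x))\<^sup>2 \<le> 2 - 2 * bhattacharyya p q"
    using has_sum_mono_neutral[OF has_sum_finite[of "{x}" "\<lambda>x. (sqrt (pmf p x) - sqrt (pmf q x))\<^sup>2"]
        hellinger_has_sum[of p q]] by simp
  ultimately show ?thesis by linarith
qed

lemma hellinger_angle_bounds:
  assumes "p \<noteq> q"
  shows "hellinger_angle p q \<in> {0<..pi / 2}"
  using bhattacharyya_less_1[OF assms] bhattacharyya_nonneg[of p q]
    arccos_less_arccos[of "bhattacharyya p q" 1] arccos_le_pi2[of "bhattacharyya p q"]
  unfolding hellinger_angle_def by simp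

lemma pmf_midpoint_pmf:
  assumes "p \<noteq> q"
  shows "pmf (midpoint_pmf p q) x =
    (sin (hellinger_angle p q / 2) / sin (hellinger_angle p q)
       * (sqrt (pmf p x) + sqrt (pmf q x)))\<^sup>2"
proof -
  define t where "t = hellinger_angle p q"
  define c where "c = sin (t / 2) / sin t"
  define f where "f = (\<lambda>x. (c * (sqrt (pmf p x) + sqrt (pmf q x)))\<^sup>2)"
  have t: "0 < t" "t \<le> pi / 2"
    using hellinger_angle_bounds[OF assms] by (auto simp: t_def)
  have cos_t: "cos t = bhattacharyya p q"
    unfolding t_def hellinger_angle_def
    using bhattacharyya_less_1[OF assms] bhattacharyya_nonneg[of p q] by (intro cos_arccos) auto
  have "sin (t / 2) > 0" "cos (t / 2) > 0"
    using t by (auto intro!: sin_gt_zero cos_gt_zero)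
  moreover have "sin t = 2 * sin (t / 2) * cos (t / 2)" "cos t = 2 * (cos (t / 2))\<^sup>2 - 1"
    using sin_double[of "t / 2"] cos_double_cos[of "t / 2"] by simp_all
  ultimately have c1: "c\<^sup>2 * (2 + 2 * cos t) = 1"
    by (simp add: c_def field_simps power2_eq_square)
  have "((\<lambda>x. c\<^sup>2 * ((pmf p x + pmf q x) + 2 * sqrt (pmf p x * pmf q x))) has_sum
      (c\<^sup>2 * ((1 + 1) + 2 * bhattacharyya p q))) UNIV"
    by (intro has_sum_add has_sum_cmult_right pmf_has_sum bhattacharyya_has_sum)
  moreover have "c\<^sup>2 * ((pmf p x + pmf q x) + 2 * sqrt (pmf p x * pmf q x)) = f x" for x
    by (simp add: f_def power_mult_distrib power2_sum real_sqrt_mult)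
  ultimately have sum_f: "(f has_sum 1) UNIV"
    using c1 cos_t by simp
  have nonneg: "f x \<ge> 0" for x
    by (simp add: f_def)
  have summable: "Infinite_Set_Sum.abs_summable_on f UNIV"
    using sum_f nonneg
    by (auto simp: abs_summable_equivalent [symmetric] summable_on_def)
  have "(\<integral>\<^sup>+x. ennreal (f x) \<partial>count_space UNIV) = 1"
    using summable nonneg infsetsum_infsum[OF summable] infsumI[OF sum_f]
    by (subst nn_integral_conv_infsetsum) auto
  then have "pmf (embed_pmf f) x = f x"
    using nonneg by (intro pmf_embed_pmf)
  then show ?thesis
    by (simp add: midpoint_pmf_def f_def c_def t_def)
qed

lemma sqrt_pmf_midpoint_pmf:
  assumes "p \<noteq> q"
  shows "sqrt (pmf (midpoint_pmf p q) x) =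
    sin (hellinger_angle p q / 2) / sin (hellinger_angle p q)
      * (sqrt (pmf p x) + sqrt (pmf q x))"
proof -
  have "hellinger_angle p q > 0" "hellinger_angle p q \<le> pi / 2"
    using hellinger_angle_bounds[OF assms] by auto
  then have "sin (hellinger_angle p q / 2) > 0" "sin (hellinger_angle p q) > 0"
    by (auto intro!: sin_gt_zero)
  then show ?thesis
    unfolding pmf_midpoint_pmf[OF assms] by (simp add: real_sqrt_abs)
qed

end

theory Submission
  imports Defs
begin

text \<open>
  Write $a = \sqrt{p_0}$, $b = \sqrt{p_1}$, $w = \sqrt u = (a + b)/K$ with $K = 2\cos(\theta/2)$,
  and $D = (a - b)/w$, so that $T$ averages $D(X_i)$ and $|D| \le K$.
  For $f = \sqrt p$, expanding $f = w + (f - w)$ and bounding $D \ge -K$ in the quadratic term gives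
  $E_p D = \langle f, D f\rangle \ge 2\langle f, a - b\rangle - K \|f - w\|^2
  = 4(B(p, p_0) - \cos(\theta/2))$, since $\langle w, D w\rangle = 0$ and $K w = a + b$.
  Hence $E_p D$ is bounded away from $0$ uniformly over $H_0$, and Hoeffding's inequality applies.
  The case of $H_1$ follows by exchanging $p_0$ and $p_1$, which turns $T$ into $-T$.
\<close>

text \<open>This is the function $D$ of the overview, one summand of the statistic.\<close>

definition hellinger_score :: "'a pmf \<Rightarrow> 'a pmf \<Rightarrow> 'a \<Rightarrow> real" where
  "hellinger_score p q x = sqrt (pmf p x / pmf (midpoint_pmf p q) x)
     - sqrt (pmf q x / pmf (midpoint_pmf p q) x)"

lemma hellinger_stat_score:
  "hellinger_stat p q m X = (\<Sum>i = 1..m. hellinger_score p q (X i)) / real m"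
  by (simp add: hellinger_stat_def hellinger_score_def)

lemma prob_pmf_Compl: "measure_pmf.prob p (- A) = 1 - measure_pmf.prob p A"
  using measure_pmf.prob_compl[of A p] by (simp add: Compl_eq_Diff_UNIV)

lemma midpoint_pmf_commute: "midpoint_pmf p q = midpoint_pmf q p"
  by (simp add: midpoint_pmf_def hellinger_angle_def bhattacharyya_def mult.commute add.commute)

lemma hellinger_angle_commute: "hellinger_angle p q = hellinger_angle q p"
  by (simp add: hellinger_angle_def bhattacharyya_def mult.commute)

lemma hellinger_stat_swap: "hellinger_stat q p m X = - hellinger_stat p q m X"
  unfolding hellinger_stat_def midpoint_pmf_commute[of q p]
  by (simp add: sum_subtractf algebra_simps)

lemma cos_half_hellinger_angle_pos:
  assumes "p \<noteq> q"
  shows "cos (hellinger_angle p q / 2) > 0"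
  using hellinger_angle_bounds[OF assms] by (intro cos_gt_zero) auto

text \<open>Double-angle formula for \<theta> with cos \<theta> = $B(p,q)$. It is used to evaluate
  the constant term of the bound on the mean.\<close>

lemma bhattacharyya_cos_half:
  assumes "p \<noteq> q"
  shows "1 + bhattacharyya p q = 2 * (cos (hellinger_angle p q / 2))\<^sup>2"
proof -
  have "cos (hellinger_angle p q) = bhattacharyya p q"
    unfolding hellinger_angle_def
    using bhattacharyya_less_1[OF assms] bhattacharyya_nonneg[of p q] by (intro cos_arccos) auto
  then show ?thesis
    using cos_double_cos[of "hellinger_angle p q / 2"] by simp
qed

text \<open>Since sin \<theta> = 2 sin(\<theta>/2) cos(\<theta>/2), the normalising factor of $w$ is
  $1/K$. Where $a = b = 0$ both sides are 0 because \<open>x / 0 = 0\<close>, so no support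
  condition appears.\<close>

lemma hellinger_score_eq:
  assumes "p \<noteq> q"
  shows "hellinger_score p q x = 2 * cos (hellinger_angle p q / 2)
    * ((sqrt (pmf p x) - sqrt (pmf q x)) / (sqrt (pmf p x) + sqrt (pmf q x)))"
proof -
  define t where "t = hellinger_angle p q"
  have t: "0 < t" "t \<le> pi / 2"
    using hellinger_angle_bounds[OF assms] by (auto simp: t_def)
  then have "sin (t / 2) > 0"
    by (auto intro!: sin_gt_zero)
  moreover have "cos (t / 2) > 0"
    using cos_half_hellinger_angle_pos[OF assms] by (simp add: t_def)
  moreover have "sin t = 2 * sin (t / 2) * cos (t / 2)"
    using sin_double[of "t / 2"] by simp
  ultimately have "sin (t / 2) / sin t = 1 / (2 * cos (t / 2))"
    by (simp add: field_simps)
  then have "sqrt (pmf (midpoint_pmf p q) x)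
      = 1 / (2 * cos (t / 2)) * (sqrt (pmf p x) + sqrt (pmf q x))"
    using sqrt_pmf_midpoint_pmf[OF assms, of x] by (simp add: t_def)
  then show ?thesis
    by (simp add: hellinger_score_def real_sqrt_divide t_def[symmetric]
        diff_divide_distrib right_diff_distrib mult.commute)
qed

lemma hellinger_score_bound:
  assumes "p \<noteq> q"
  shows "\<bar>hellinger_score p q x\<bar> \<le> 2"
proof -
  define a b where "a = sqrt (pmf p x)" and "b = sqrt (pmf q x)"
  have "a \<ge> 0" "b \<ge> 0"
    by (auto simp: a_def b_def)
  then have "\<bar>a - b\<bar> \<le> \<bar>a + b\<bar>"
    by linarith
  then have "\<bar>(a - b) / (a + b)\<bar> \<le> 1"
    \<comment> \<open>\<open>divide_le_eq_1\<close> also admits a zero denominator, which covers $a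
      = b = 0$.\<close>
    unfolding abs_divide by (intro divide_le_eq_1[THEN iffD2]) auto
  moreover have "\<bar>cos (hellinger_angle p q / 2)\<bar> \<le> 1"
    by simp
  ultimately have "\<bar>cos (hellinger_angle p q / 2)\<bar> * \<bar>(a - b) / (a + b)\<bar> \<le> 1"
    by (intro mult_le_one) auto
  then show ?thesis
    unfolding hellinger_score_eq[OF assms] a_def[symmetric] b_def[symmetric] abs_mult by simp
qed

text \<open>Expand $(D + K)(f - w)^2$, which is nonnegative, using $(D + K) w = 2a$. The resulting
  terms are masses and square roots of products of masses, so each has a known sum over $x$.\<close>

lemma pmf_times_hellinger_score_ge:
  fixes p p0 p1 :: "'a pmf"
  assumes "p0 \<noteq> p1"
  defines "k \<equiv> cos (hellinger_angle p0 p1 / 2)"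
  shows "pmf p x * hellinger_score p0 p1 x \<ge>
    4 * sqrt (pmf p x * pmf p0 x) - 2 * k * pmf p x
      - 1 / k * (pmf p0 x + sqrt (pmf p0 x * pmf p1 x))"
proof -
  define f a b where "f = sqrt (pmf p x)" and "a = sqrt (pmf p0 x)" and "b = sqrt (pmf p1 x)"
  have ab: "a \<ge> 0" "b \<ge> 0"
    by (auto simp: a_def b_def)
  have k: "k > 0"
    unfolding k_def by (rule cos_half_hellinger_angle_pos[OF assms(1)])
  have sq: "pmf p x = f\<^sup>2" "pmf p0 x = a\<^sup>2" "sqrt (pmf p x * pmf p0 x) = f * a"
    "sqrt (pmf p0 x * pmf p1 x) = a * b"
    by (simp_all add: f_def a_def b_def real_sqrt_mult)
  have "f\<^sup>2 * (2 * k * ((a - b) / (a + b))) \<ge> 4 * (f * a) - 2 * k * f\<^sup>2 - 1 / k * (a\<^sup>2 + a * b)"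
  proof (cases "a + b = 0")
    \<comment> \<open>Here $D = 0$ and the claim reduces to $-2 k f^2$ being at most 0.\<close>
    case True
    then have "a = 0" "b = 0"
      using ab by auto
    then show ?thesis
      using k by simp
  next
    case False
    then have s: "a + b > 0"
      using ab by simp
    \<comment> \<open>The slack is $(D + K)(f - w)^2$ with $K = 2k$ and $w = (a + b)/K$.\<close>
    have "f\<^sup>2 * (2 * k * ((a - b) / (a + b))) - (4 * (f * a) - 2 * k * f\<^sup>2 - 1 / k * (a\<^sup>2 + a * b))
        = a / (k * (a + b)) * (2 * k * f - (a + b))\<^sup>2"
      using k s by (simp add: field_simps power2_eq_square)
    also have "\<dots> \<ge> 0"
      using k s ab by simp
    finally show ?thesis by simp
  qed
  then show ?thesis
    unfolding hellinger_score_eq[OF assms(1)] a_def[symmetric] b_def[symmetric] k_def[symmetric]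
    \<comment> \<open>The products under square roots go first: rewriting the bare masses would
      destroy their pattern.\<close>
    unfolding sq(3,4)
    unfolding sq(1,2) .
qed

lemma expectation_hellinger_score_ge:
  assumes "p0 \<noteq> p1"
  shows "measure_pmf.expectation p (hellinger_score p0 p1)
    \<ge> 4 * (bhattacharyya p p0 - cos (hellinger_angle p0 p1 / 2))"
proof -
  define k where "k = cos (hellinger_angle p0 p1 / 2)"
  have k: "k > 0"
    unfolding k_def by (rule cos_half_hellinger_angle_pos[OF assms])
  let ?g = "\<lambda>x. pmf p x * hellinger_score p0 p1 x"
  have "(\<lambda>x. 2 * pmf p x) summable_on UNIV"
    using has_sum_cmult_right[OF pmf_has_sum[of p], of 2] by (rule has_sum_imp_summable)
  \<comment> \<open>Boundedness of $D$ gives absolute summability, needed to pass between the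
    expectation and \<open>infsum\<close>.\<close>
  moreover have "norm (?g x) \<le> 2 * pmf p x" for x
    using mult_left_mono[OF hellinger_score_bound[OF assms], of "pmf p x" x]
    by (simp add: abs_mult mult.commute)
  ultimately have "(\<lambda>x. norm (?g x)) summable_on UNIV"
    by (rule summable_on_comparison_test) auto
  then have summable: "?g summable_on UNIV" "Infinite_Set_Sum.abs_summable_on ?g UNIV"
    by (auto intro: abs_summable_summable simp: abs_summable_equivalent[symmetric])
  have "((\<lambda>x. 4 * sqrt (pmf p x * pmf p0 x) + - (2 * k) * pmf p x
      + - (1 / k) * (pmf p0 x + sqrt (pmf p0 x * pmf p1 x))) has_sum
    (4 * bhattacharyya p p0 + - (2 * k) * 1 + - (1 / k) * (1 + bhattacharyya p0 p1))) UNIV"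
    by (intro has_sum_add has_sum_cmult_right pmf_has_sum bhattacharyya_has_sum)
  then have "4 * bhattacharyya p p0 - 2 * k - 1 / k * (1 + bhattacharyya p0 p1) \<le> infsum ?g UNIV"
    using pmf_times_hellinger_score_ge[OF assms, folded k_def]
    by (intro has_sum_mono[OF _ has_sum_infsum[OF summable(1)]]) auto
  \<comment> \<open>The second loss thus equals the first, $2k$; together they give the threshold
    $4k$.\<close>
  moreover have "1 / k * (1 + bhattacharyya p0 p1) = 2 * k"
    using bhattacharyya_cos_half[OF assms] k by (simp add: k_def power2_eq_square)
  ultimately have "4 * (bhattacharyya p p0 - k) \<le> infsum ?g UNIV"
    by simp
  then show ?thesis
    unfolding pmf_expectation_eq_infsetsum infsetsum_infsum[OF summable(2)] k_def .
qed

text \<open>Hoeffding's inequality for independent scores in $[-2, 2]$ whose common mean is at least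
  $4$\<epsilon>. The event includes ties, so the bound serves both hypotheses after exchanging
  \<open>p0\<close> and \<open>p1\<close>.\<close>

lemma prob_hellinger_stat_nonpos:
  assumes "p0 \<noteq> p1" and "m \<ge> 1" and "\<epsilon> \<ge> 0"
    and "hellinger_sq p p0 \<le> 1 - cos (hellinger_angle p0 p1 / 2) - \<epsilon>"
  shows "measure_pmf.prob (iid_sample m p) {X. hellinger_stat p0 p1 m X \<le> 0}
    \<le> exp (- 2 * real m * \<epsilon>\<^sup>2)"
proof -
  let ?M = "iid_sample m p" and ?h = "hellinger_score p0 p1"
  have comp: "map_pmf (\<lambda>X. X i) ?M = p" if "i \<in> {1..m}" for i
    using that unfolding iid_sample_def by (subst Pi_pmf_component) auto
  have expect: "measure_pmf.expectation ?M (\<lambda>X. ?h (X i)) = measure_pmf.expectation p ?h"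
    if "i \<in> {1..m}" for i
    using integral_map_pmf[of "\<lambda>X. X i" ?M ?h] comp[OF that] by simp
  define \<mu> where "\<mu> = (\<Sum>i\<in>{1..m}. measure_pmf.expectation ?M (\<lambda>X. ?h (X i)))"
  interpret Hoeffding_ineq "measure_pmf ?M" "{1..m}" "\<lambda>i X. ?h (X i)" "\<lambda>_. - 2" "\<lambda>_. 2" \<mu>
  proof unfold_locales
    show "prob_space.indep_vars ?M (\<lambda>_. borel) (\<lambda>i X. ?h (X i)) {1..m}"
      unfolding iid_sample_def
      by (rule prob_space.indep_vars_compose2[OF measure_pmf.prob_space_axioms indep_vars_Pi_pmf]) auto
  qed (use hellinger_score_bound[OF assms(1)] in \<open>auto simp: abs_le_iff minus_le_iff \<mu>_def\<close>)
  have "4 * \<epsilon> \<le> 4 * (bhattacharyya p p0 - cos (hellinger_angle p0 p1 / 2))"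
    using assms(4) unfolding hellinger_sq_eq by simp
  also have "\<dots> \<le> measure_pmf.expectation p ?h"
    by (rule expectation_hellinger_score_ge[OF assms(1)])
  finally have "4 * \<epsilon> \<le> measure_pmf.expectation p ?h" .
  then have "real m * (4 * \<epsilon>) \<le> \<mu>"
    using expect by (simp add: \<mu>_def mult_left_mono)
  then have "measure_pmf.prob ?M {X. hellinger_stat p0 p1 m X \<le> 0}
      \<le> measure_pmf.prob ?M {X \<in> space ?M. (\<Sum>i\<in>{1..m}. ?h (X i)) \<le> \<mu> - real m * (4 * \<epsilon>)}"
    using assms(2) by (intro measure_pmf.finite_measure_mono)
      (auto simp: hellinger_stat_score divide_le_0_iff)
  \<comment> \<open>There are \<open>m\<close> ranges of width 4, so the exponent is $-2 (4
    m$\<epsilon>$)^2 / (16 m)$.\<close>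
  also have "\<dots> \<le> exp (- 2 * (real m * (4 * \<epsilon>))\<^sup>2 / (\<Sum>i\<in>{1..m}. (2 - - 2)\<^sup>2))"
    using assms(2,3) by (intro Hoeffding_ineq_le) auto
  also have "\<dots> = exp (- 2 * real m * \<epsilon>\<^sup>2)"
    using assms(2) by (simp add: field_simps power2_eq_square)
  finally show ?thesis .
qed

theorem theorem4:
  fixes p0 p1 :: "'a::countable pmf" and r :: real
  assumes "p0 \<noteq> p1"
    and "r < 1 - cos (hellinger_angle p0 p1 / 2)"
  shows "\<forall>\<delta>\<in>{0<..<1::real}. \<exists>m0\<ge>1. \<forall>m\<ge>m0. \<forall>p.
    (hellinger_sq p p0 \<le> r \<longrightarrow>
       measure_pmf.prob (iid_sample m p) {X. hellinger_test p0 p1 m X = H0} \<ge> 1 - \<delta>) \<and>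
    (hellinger_sq p p1 \<le> r \<longrightarrow>
       measure_pmf.prob (iid_sample m p) {X. hellinger_test p0 p1 m X = H1} \<ge> 1 - \<delta>)"
proof
  fix \<delta> :: real
  assume \<delta>: "\<delta> \<in> {0<..<1}"
  define \<epsilon> where "\<epsilon> = 1 - cos (hellinger_angle p0 p1 / 2) - r"
  have \<epsilon>: "\<epsilon> > 0"
    using assms(2) by (simp add: \<epsilon>_def)
  \<comment> \<open>Solves exp(-2 m \<epsilon>^2) \<le> \<delta> for \<open>m\<close>, independently
    of the sampled distribution; the maximum with 1 keeps the sample nonempty.\<close>
  define m0 where "m0 = max 1 (nat \<lceil>- ln \<delta> / (2 * \<epsilon>\<^sup>2)\<rceil>)"
  have small: "exp (- 2 * real m * \<epsilon>\<^sup>2) \<le> \<delta>" if "m \<ge> m0" for m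
  proof -
    have "- ln \<delta> / (2 * \<epsilon>\<^sup>2) \<le> real m"
      using that unfolding m0_def by linarith
    then have "- 2 * real m * \<epsilon>\<^sup>2 \<le> ln \<delta>"
      using \<epsilon> by (simp add: field_simps)
    then show ?thesis
      using \<delta> by (simp add: ln_ge_iff)
  qed
  have H0: "measure_pmf.prob (iid_sample m p) {X. hellinger_test p0 p1 m X = H0} \<ge> 1 - \<delta>"
    if "m \<ge> m0" "hellinger_sq p p0 \<le> r" for m p
  proof -
    have "measure_pmf.prob (iid_sample m p) (- {X. hellinger_stat p0 p1 m X \<le> 0}) \<ge> 1 - \<delta>"
      using prob_hellinger_stat_nonpos[OF assms(1), of m \<epsilon> p] small[OF that(1)] that \<epsilon>
      by (simp add: \<epsilon>_def m0_def prob_pmf_Compl)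
    \<comment> \<open>Only an inclusion of events, because a tie also declares
      \<open>H0\<close>.\<close>
    moreover have "measure_pmf.prob (iid_sample m p) (- {X. hellinger_stat p0 p1 m X \<le> 0})
        \<le> measure_pmf.prob (iid_sample m p) {X. hellinger_test p0 p1 m X = H0}"
      by (intro measure_pmf.finite_measure_mono) (auto simp: hellinger_test_def)
    ultimately show ?thesis by linarith
  qed
  have H1: "measure_pmf.prob (iid_sample m p) {X. hellinger_test p0 p1 m X = H1} \<ge> 1 - \<delta>"
    if "m \<ge> m0" "hellinger_sq p p1 \<le> r" for m p
  proof -
    \<comment> \<open>An equality this time: \<open>H1\<close> is declared exactly when the
      exchanged statistic is strictly positive.\<close>
    have "{X. hellinger_test p0 p1 m X = H1} = - {X. hellinger_stat p1 p0 m X \<le> 0}"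
      by (auto simp: hellinger_test_def hellinger_stat_swap[of p1 p0])
    then show ?thesis
      using prob_hellinger_stat_nonpos[OF assms(1)[symmetric], of m \<epsilon> p] small[OF that(1)] that \<epsilon>
      by (simp add: \<epsilon>_def m0_def hellinger_angle_commute[of p1 p0] prob_pmf_Compl)
  qed
  show "\<exists>m0\<ge>1. \<forall>m\<ge>m0. \<forall>p.
    (hellinger_sq p p0 \<le> r \<longrightarrow>
       measure_pmf.prob (iid_sample m p) {X. hellinger_test p0 p1 m X = H0} \<ge> 1 - \<delta>) \<and>
    (hellinger_sq p p1 \<le> r \<longrightarrow>
       measure_pmf.prob (iid_sample m p) {X. hellinger_test p0 p1 m X = H1} \<ge> 1 - \<delta>)"
    using H0 H1 by (intro exI[of _ m0]) (auto simp: m0_def)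
qed

end
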